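(* Let $y_1,\dots,y_n\in\mathbb{R}^d$ be the observed data, let $\hat A\in\mathbb{R}^{d\times d}$ be the regression estimate defined in the context, let $\varepsilon_1$ and $\varepsilon_{2,1},\dots,\varepsilon_{2,d}$ be the given radii of the uncertainty sets, let the feasible domain $\mathcal{D}$ of the decision variable $x$ be convex, and let the known support set $\Xi\subseteq\mathbb{R}^d$ be bounded. Let $h(x,y)$ be differentiable, convex in the first argument and concave in the second argument. With $\Omega(\epsilon_2)$, $F_n$ and $d_w$ as defined in the context, consider (P1) the distributionally robust problem $$\min_{x\in\mathcal{D}}\ \max_{A,F}\ \mathbb{E}_{\xi_n\sim F}\big[h(x,Ay_n+\xi_n)\big]\quad\text{subject to}\quad d_w^2(F,F_n)\le\varepsilon_1,\quad A\in\Omega(\epsilon_2),$$ where $F$ ranges over probability distributions on the Borel sets of $\mathbb{R}^d$ with $F(\Xi)=1$; (P2) the problem $$\inf_{x\in\mathcal{D}}\ \max_{A\in\Omega(\epsilon_2)}\ \inf_{u\ge 0}\ \max_{\xi_i\in\Xi,\ i=1,\dots,n-1}\ u\varepsilon_1+\frac{1}{n-1}\sum_{i=1}^{n-1}\Big[h(x,Ay_n+\xi_i)-u\,\|\xi_i-(y_{i+1}-Ay_i)\|^2\Big].$$ Problems (P1) and (P2) are equivalent to the convex-concave minimax problem (P3) $$\inf_{x\in\mathcal{D}}\ \max_{A,\ \xi_i\in\Xi,\ i=1,\dots,n-1}\ \frac{1}{n-1}\sum_{i=1}^{n-1}h(x,Ay_n+\xi_i)$$ subject to $$\frac{1}{n-1}\sum_{i=1}^{n-1}\|\xi_i-(y_{i+1}-Ay_i)\|^2\le\varepsilon_1,\qquad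 \|A_i-\hat A_i\|\le\varepsilon_{2,i}\ \text{ for } i=1,\dots,d.$$
   Context: $\|\cdot\|$ is the Euclidean norm on $\mathbb{R}^d$. For a matrix $A\in\mathbb{R}^{d\times d}$, $A_i$ denotes its $i$th column. The data $y_1,\dots,y_n$ are observations of a vector autoregressive process $y_{t+1}=Ay_t+\xi_t$ with i.i.d. zero-mean noise $\xi_t\in\Xi$. The matrix $\hat A$ is the fixed least-squares regression estimate, $\hat A=\arg\min_A\|Y_+-AY_-\|_F^2$, where $Y_+=[y_2,\dots,y_n]$, $Y_-=[y_1,\dots,y_{n-1}]$ and $\|\cdot\|_F$ is the Frobenius norm. The uncertainty set for the matrix is $$\Omega(\epsilon_2)=\{A\in\mathbb{R}^{d\times d}:\ \|A_i-\hat A_i\|\le\varepsilon_{2,i}\ \text{for } i=1,\dots,d\}.$$ $F_n=\frac{1}{n-1}\sum_{i=1}^{n-1}\delta_{y_{i+1}-Ay_i}$ is the empirical distribution of the residuals $y_{i+1}-Ay_i$, $i=1,\dots,n-1$; it depends on the variable $A$. $d_w$ is the 2-Wasserstein distance for the Euclidean metric: $$d_w(\mathbb{P},\mathbb{Q})=\inf_{\pi\in\Pi(\mathbb{P},\mathbb{Q})}\sqrt{\int\|\xi-\xi'\|^2\,\pi(\mathrm{d}\xi,\mathrm{d}\xi')},$$ where $\Pi(\mathbb{P},\mathbb{Q})$ is the set of joint distributions with marginals $\mathbb{P}$ and $\mathbb{Q}$. "Equivalent" is meant in the sense of reformulation: for each $x\in\mathcal{D}$ the optimal values of the inner problems (everything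 to the right of the outer minimization over $x$) coincide. "Convex-concave" refers to the objective being convex in the minimization variable $x$ and jointly concave in the maximization variables $(A,\xi_1,\dots,\xi_{n-1})$.
   Formalization: The support set Ξ is assumed closed and convex in addition to bounded: for non-convex Ξ, such as {-2,0,2}, (P1) and (P3) can have different values, and without closedness the maxima over Ξ need not exist and (P2) can differ from (P3). *)

theory Defs
  imports "HOL-Probability.Probability"
begin

text \<open>
  Data are sequences y of which only the entries 1, ..., n are used, and a tuple of n - 1 noise
  vectors is a function on the naturals of which only the entries in {1..<n} are used.
\<close>

text \<open>The Frobenius norm of the matrix whose columns are M t for t in I.\<close>

definition frobenius_norm_cols :: "nat set \<Rightarrow> (nat \<Rightarrow> real^'d) \<Rightarrow> real" where
  "frobenius_norm_cols I M = sqrt (\<Sum>t\<in>I. \<Sum>i\<in>UNIV. (M t $ i)\<^sup>2)"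

definition residual :: "(nat \<Rightarrow> real^'d) \<Rightarrow> real^'d^'d \<Rightarrow> nat \<Rightarrow> real^'d" where
  "residual y A i = y (i + 1) - A *v y i"

text \<open>
  The residuals are the columns of the matrix Yplus - A Yminus, where Yplus = [y 2, ..., y n] and
  Yminus = [y 1, ..., y (n - 1)]. The minimizer need not be unique, since Yminus may be
  rank deficient.
\<close>

definition is_regression_estimate :: "nat \<Rightarrow> (nat \<Rightarrow> real^'d) \<Rightarrow> real^'d^'d \<Rightarrow> bool" where
  "is_regression_estimate n y Ahat \<longleftrightarrow>
     is_arg_min (\<lambda>A. (frobenius_norm_cols {1..<n} (residual y A))\<^sup>2) (\<lambda>A. True) Ahat"

definition Omega_set :: "real^'d^'d \<Rightarrow> ('d \<Rightarrow> real) \<Rightarrow> (real^'d^'d) set" where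
  "Omega_set Ahat \<epsilon>\<^sub>2 = {A. \<forall>i. norm (column i A - column i Ahat) \<le> \<epsilon>\<^sub>2 i}"

definition empirical_dist :: "nat \<Rightarrow> (nat \<Rightarrow> real^'d) \<Rightarrow> real^'d^'d \<Rightarrow> (real^'d) measure" where
  "empirical_dist n y A = distr (uniform_count_measure {1..<n}) borel (residual y A)"

lemma emeasure_empirical_dist:
  fixes y :: "nat \<Rightarrow> real^'d"
  assumes "n \<ge> 2" and "S \<in> sets borel"
  shows "emeasure (empirical_dist n y A) S
    = ennreal (1 / real (n - 1) * (\<Sum>i = 1..n - 1. indicator S (y (i + 1) - A *v y i)))"
proof -
  have I: "{1..n - 1} = {1..<n}" using assms(1) by auto
  have m: "residual y A \<in> measurable (uniform_count_measure {1..<n}) borel"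
    by (simp add: measurable_def space_uniform_count_measure sets_uniform_count_measure)
  have c: "(\<Sum>i = 1..n - 1. indicator S (y (i + 1) - A *v y i) :: real)
      = real (card (residual y A -` S \<inter> {1..<n}))"
    unfolding I by (simp add: indicator_def residual_def sum.If_cases Int_def conj_commute)
  show ?thesis
    unfolding empirical_dist_def emeasure_distr[OF m assms(2)] c
    by (simp add: space_uniform_count_measure emeasure_uniform_count_measure)
qed

definition couplings :: "'a::euclidean_space measure \<Rightarrow> 'a measure \<Rightarrow> ('a \<times> 'a) measure set" where
  "couplings P Q = {\<pi>. prob_space \<pi> \<and> sets \<pi> = sets (borel \<Otimes>\<^sub>M borel)
     \<and> distr \<pi> borel fst = P \<and> distr \<pi> borel snd = Q}"

definition ennreal_sqrt :: "ennreal \<Rightarrow> ennreal" where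
  "ennreal_sqrt c = (if c = \<infinity> then \<infinity> else ennreal (sqrt (enn2real c)))"

text \<open>The values are extended, because the transport cost may be infinite.\<close>

definition wasserstein2 :: "'a::euclidean_space measure \<Rightarrow> 'a measure \<Rightarrow> ennreal" where
  "wasserstein2 P Q =
     (INF \<pi>\<in>couplings P Q. ennreal_sqrt (\<integral>\<^sup>+ (\<xi>, \<xi>'). ennreal ((norm (\<xi> - \<xi>'))\<^sup>2) \<partial>\<pi>))"

definition distributions_on :: "'a::euclidean_space set \<Rightarrow> 'a measure set" where
  "distributions_on \<Xi> = {F. prob_space F \<and> sets F = sets borel \<and> emeasure F \<Xi> = 1}"

text \<open>
  For each decision x, the optimal values of the inner problems of the three formulations. They are
  suprema and infima in ereal, so an infeasible inner maximization has value minus infinity.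
\<close>

definition dro_value ::
  "nat \<Rightarrow> (nat \<Rightarrow> real^'d) \<Rightarrow> real^'d^'d \<Rightarrow> real \<Rightarrow> ('d \<Rightarrow> real) \<Rightarrow> (real^'d) set
    \<Rightarrow> ('x \<Rightarrow> real^'d \<Rightarrow> real) \<Rightarrow> 'x \<Rightarrow> ereal" where
  "dro_value n y Ahat \<epsilon>\<^sub>1 \<epsilon>\<^sub>2 \<Xi> h x =
     (SUP (A, F) \<in> {(A, F). A \<in> Omega_set Ahat \<epsilon>\<^sub>2 \<and> F \<in> distributions_on \<Xi>
                     \<and> (wasserstein2 F (empirical_dist n y A))\<^sup>2 \<le> ennreal \<epsilon>\<^sub>1}.
        ereal (\<integral>\<xi>. h x (A *v y n + \<xi>) \<partial>F))"

definition dual_value ::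
  "nat \<Rightarrow> (nat \<Rightarrow> real^'d) \<Rightarrow> real^'d^'d \<Rightarrow> real \<Rightarrow> ('d \<Rightarrow> real) \<Rightarrow> (real^'d) set
    \<Rightarrow> ('x \<Rightarrow> real^'d \<Rightarrow> real) \<Rightarrow> 'x \<Rightarrow> ereal" where
  "dual_value n y Ahat \<epsilon>\<^sub>1 \<epsilon>\<^sub>2 \<Xi> h x =
     (SUP A \<in> Omega_set Ahat \<epsilon>\<^sub>2. INF u \<in> {0..}. SUP \<xi> \<in> {\<xi>. \<forall>i\<in>{1..<n}. \<xi> i \<in> \<Xi>}.
        ereal (u * \<epsilon>\<^sub>1 + 1 / real (n - 1) *
          (\<Sum>i = 1..n - 1. h x (A *v y n + \<xi> i) - u * (norm (\<xi> i - (y (i + 1) - A *v y i)))\<^sup>2)))"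

definition minimax_objective ::
  "nat \<Rightarrow> (nat \<Rightarrow> real^'d) \<Rightarrow> ('x \<Rightarrow> real^'d \<Rightarrow> real)
    \<Rightarrow> 'x \<Rightarrow> real^'d^'d \<Rightarrow> (nat \<Rightarrow> real^'d) \<Rightarrow> real" where
  "minimax_objective n y h x A \<xi> = 1 / real (n - 1) * (\<Sum>i = 1..n - 1. h x (A *v y n + \<xi> i))"

definition minimax_feasible ::
  "nat \<Rightarrow> (nat \<Rightarrow> real^'d) \<Rightarrow> real^'d^'d \<Rightarrow> real \<Rightarrow> ('d \<Rightarrow> real) \<Rightarrow> (real^'d) set
    \<Rightarrow> ((real^'d^'d) \<times> (nat \<Rightarrow> real^'d)) set" where
  "minimax_feasible n y Ahat \<epsilon>\<^sub>1 \<epsilon>\<^sub>2 \<Xi> =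
     {(A, \<xi>). (\<forall>i\<in>{1..<n}. \<xi> i \<in> \<Xi>)
        \<and> 1 / real (n - 1) * (\<Sum>i = 1..n - 1. (norm (\<xi> i - (y (i + 1) - A *v y i)))\<^sup>2) \<le> \<epsilon>\<^sub>1
        \<and> (\<forall>i. norm (column i A - column i Ahat) \<le> \<epsilon>\<^sub>2 i)}"

definition minimax_value ::
  "nat \<Rightarrow> (nat \<Rightarrow> real^'d) \<Rightarrow> real^'d^'d \<Rightarrow> real \<Rightarrow> ('d \<Rightarrow> real) \<Rightarrow> (real^'d) set
    \<Rightarrow> ('x \<Rightarrow> real^'d \<Rightarrow> real) \<Rightarrow> 'x \<Rightarrow> ereal" where
  "minimax_value n y Ahat \<epsilon>\<^sub>1 \<epsilon>\<^sub>2 \<Xi> h x =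
     (SUP (A, \<xi>) \<in> minimax_feasible n y Ahat \<epsilon>\<^sub>1 \<epsilon>\<^sub>2 \<Xi>. ereal (minimax_objective n y h x A \<xi>))"

text \<open>
  Convexity and concavity in the pair (A, \<xi>) are written out, because functions on the naturals are
  not an instance of the class of real vector spaces required by convex and concave_on.
\<close>

definition jointly_convex_set :: "((real^'d^'d) \<times> (nat \<Rightarrow> real^'d)) set \<Rightarrow> bool" where
  "jointly_convex_set S \<longleftrightarrow>
     (\<forall>(A, \<xi>)\<in>S. \<forall>(B, \<eta>)\<in>S. \<forall>t\<in>{0..1}.
        ((1 - t) *\<^sub>R A + t *\<^sub>R B, \<lambda>i. (1 - t) *\<^sub>R \<xi> i + t *\<^sub>R \<eta> i) \<in> S)"

definition jointly_concave :: "(real^'d^'d \<Rightarrow> (nat \<Rightarrow> real^'d) \<Rightarrow> real) \<Rightarrow> bool" where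
  "jointly_concave f \<longleftrightarrow>
     (\<forall>A \<xi> B \<eta>. \<forall>t\<in>{0..1}.
        (1 - t) * f A \<xi> + t * f B \<eta>
          \<le> f ((1 - t) *\<^sub>R A + t *\<^sub>R B) (\<lambda>i. (1 - t) *\<^sub>R \<xi> i + t *\<^sub>R \<eta> i))"

end

theory Submission
  imports Defs
begin

text \<open>
  For a fixed decision x, the three inner values are compared in a circle:
  minimax value \<open>\<le>\<close> robust value \<open>\<le>\<close> dual value \<open>\<le>\<close> minimax value. Since A is an outer maximization
  variable in all three, it may be fixed as well; then \<open>g z = h x (A y n + z)\<close> is concave, hence
  continuous, and the residuals \<open>r i = y (i + 1) - A y i\<close> are given points.

  First inequality (\<open>minimax_value_le_dro_value\<close>): a feasible tuple \<open>\<xi>\<close> gives the distribution with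
  equal mass on each \<open>\<xi> i\<close>. Its expectation of g is the minimax objective, and moving \<open>\<xi> i\<close> to
  \<open>r i\<close> is a coupling whose cost is the constraint function, so the distribution is feasible.

  Second inequality (\<open>weak_duality_transport\<close>): let \<open>\<phi> s\<close> be the maximum over z in \<open>\<Xi>\<close> of
  \<open>g z - u * norm (z - s)^2\<close>. Integrating \<open>g z \<le> \<phi> s + u * norm (z - s)^2\<close> against a nearly optimal
  coupling of F and the empirical distribution bounds the expectation of g by \<open>u * \<epsilon>\<^sub>1\<close> plus the
  mean of the \<open>\<phi> (r i)\<close>, which is attained by a tuple of maximizers.

  Third inequality (\<open>convexlike_lagrange_multiplier\<close>): strong duality for the finite-dimensional
  problem. The constraint may have no strictly feasible point (for instance if \<open>\<epsilon>\<^sub>1 = 0\<close>), so no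
  multiplier need attain the infimum over u. Compactness of \<open>\<Xi>\<close> replaces this condition: the set of
  pairs (a, b) with \<open>a \<le> f \<xi>\<close> and \<open>c \<xi> \<le> b\<close> for some \<open>\<xi>\<close>, where f is the objective and c the
  transport cost, is convex and closed. If v exceeds the constrained maximum, it does not contain
  \<open>(v, \<epsilon>\<^sub>1)\<close>, and a strictly separating line yields a multiplier u for which the Lagrangian
  stays below v.

  Concavity and convexity of the minimax problem hold because \<open>A y n + \<xi> i\<close> and
  \<open>\<xi> i - (y (i + 1) - A y i)\<close> are affine in the pair \<open>(A, \<xi>)\<close>.
\<close>

section \<open>Lagrange multipliers without a constraint qualification\<close>

lemma convex_norm_power2:
  fixes a b :: "'a::real_inner"
  assumes "t \<in> {0..1}"
  shows "(norm ((1 - t) *\<^sub>R a + t *\<^sub>R b))\<^sup>2 \<le> (1 - t) * (norm a)\<^sup>2 + t * (norm b)\<^sup>2"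
proof -
  have "(1 - t) * (norm a)\<^sup>2 + t * (norm b)\<^sup>2 - (norm ((1 - t) *\<^sub>R a + t *\<^sub>R b))\<^sup>2
      = t * (1 - t) * (norm (a - b))\<^sup>2"
    by (simp add: power2_norm_eq_inner inner_add_left inner_add_right inner_diff_left
        inner_diff_right inner_commute[of b a] algebra_simps)
  moreover have "\<dots> \<ge> 0" using assms by simp
  ultimately show ?thesis by linarith
qed

lemma concave_on_UNIV_imp_continuous:
  fixes f :: "'a::euclidean_space \<Rightarrow> real"
  assumes "concave_on UNIV f"
  shows "continuous_on UNIV f"
proof -
  have "continuous_on UNIV (\<lambda>z. - (- f z))"
    using assms by (intro continuous_on_minus convex_on_continuous) (auto simp: concave_on_def)
  then show ?thesis by simp
qed

text \<open>
  Lagrangian duality over a compact set K that need not carry a linear structure: f and c are only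
  required to be concave-like and convex-like in the sense of Fan. The strict bound v, in place of
  the constrained maximum itself, makes a multiplier exist without a constraint qualification.
  It also covers the infeasible case, in which every v is allowed.
\<close>

lemma convexlike_lagrange_multiplier:
  fixes f c :: "'k::topological_space \<Rightarrow> real"
  assumes K: "compact K" and f: "continuous_on K f" and c: "continuous_on K c"
    and like: "\<And>k l t. k \<in> K \<Longrightarrow> l \<in> K \<Longrightarrow> t \<in> {0..1} \<Longrightarrow>
      \<exists>m\<in>K. (1 - t) * f k + t * f l \<le> f m \<and> c m \<le> (1 - t) * c k + t * c l"
    and less: "\<And>k. k \<in> K \<Longrightarrow> c k \<le> \<epsilon> \<Longrightarrow> f k < v"
  shows "\<exists>u\<ge>0. \<forall>k\<in>K. f k + u * (\<epsilon> - c k) \<le> v"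
proof (cases "K = {}")
  case True
  then show ?thesis by auto
next
  case False
  then obtain k0 where k0: "k0 \<in> K" by auto
  define S where "S = {(a, b). \<exists>k\<in>K. a \<le> f k \<and> c k \<le> b}"
  have "convex S"
    unfolding convex_alt
  proof (intro ballI allI impI)
    fix p q :: "real \<times> real" and t :: real
    assume "p \<in> S" "q \<in> S" and t: "0 \<le> t \<and> t \<le> 1"
    then obtain k l where k: "k \<in> K" "fst p \<le> f k" "c k \<le> snd p"
      and l: "l \<in> K" "fst q \<le> f l" "c l \<le> snd q"
      by (auto simp: S_def)
    obtain m where "m \<in> K" "(1 - t) * f k + t * f l \<le> f m" "c m \<le> (1 - t) * c k + t * c l"
      using like[OF k(1) l(1)] t by auto
    moreover have "(1 - t) * fst p + t * fst q \<le> (1 - t) * f k + t * f l"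
      and "(1 - t) * c k + t * c l \<le> (1 - t) * snd p + t * snd q"
      using k l t by (auto intro!: add_mono mult_left_mono)
    ultimately show "(1 - t) *\<^sub>R p + t *\<^sub>R q \<in> S"
      by (force simp: S_def case_prod_beta)
  qed
  moreover have "closed S"
  proof -
    have "S = (\<Union>x\<in>(\<lambda>k. (f k, c k)) ` K. \<Union>y\<in>{..0} \<times> {0..}. {x + y})" (is "_ = ?R")
    proof (intro equalityI subsetI)
      fix p assume "p \<in> S"
      then obtain k where "k \<in> K" "fst p \<le> f k" "c k \<le> snd p"
        by (auto simp: S_def)
      then show "p \<in> ?R"
        by (intro UN_I[of "(f k, c k)"] UN_I[of "(fst p - f k, snd p - c k)"])
          (auto simp: prod_eq_iff)
    qed (force simp: S_def)
    then show ?thesis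
      by (simp only:) (intro compact_closed_sums compact_continuous_image closed_Times
          continuous_intros f c K closed_atMost closed_atLeast)
  qed
  moreover have "(v, \<epsilon>) \<notin> S" using less by (force simp: S_def)
  ultimately have "\<exists>z \<gamma>. inner z (v, \<epsilon>) < \<gamma> \<and> (\<forall>s\<in>S. inner z s > \<gamma>)"
    by (rule separating_hyperplane_closed_point)
  then obtain z \<gamma> where v: "inner z (v, \<epsilon>) < \<gamma>" and z: "\<forall>s\<in>S. inner z s > \<gamma>" by blast
  obtain p q where pq: "z = (p, q)" by (cases z)
  have sep: "p * v + q * \<epsilon> < \<gamma>" using v by (simp add: pq)
  have below: "\<gamma> < p * a + q * b" if "k \<in> K" "a \<le> f k" "c k \<le> b" for k a b
  proof -
    have "(a, b) \<in> S" using that by (auto simp: S_def)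
    then show ?thesis using z by (force simp: pq)
  qed
  \<comment> \<open>S is unbounded towards smaller a and larger b, which determines the signs of the normal.\<close>
  have p: "p \<le> 0"
  proof (rule ccontr)
    assume "\<not> p \<le> 0"
    then have "p > 0" by simp
    define d where "d = \<bar>p * f k0 + q * c k0 - \<gamma>\<bar> / p"
    have "\<gamma> < p * (f k0 - d) + q * c k0" using \<open>p > 0\<close> by (intro below[OF k0]) (auto simp: d_def)
    moreover have "p * d = \<bar>p * f k0 + q * c k0 - \<gamma>\<bar>" using \<open>p > 0\<close> by (simp add: d_def)
    ultimately show False by (simp add: right_diff_distrib)
  qed
  have q: "q \<ge> 0"
  proof (rule ccontr)
    assume "\<not> q \<ge> 0"
    then have "q < 0" by simp
    define d where "d = \<bar>p * f k0 + q * c k0 - \<gamma>\<bar> / (- q)"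
    have "d \<ge> 0" unfolding d_def using \<open>q < 0\<close> by (intro divide_nonneg_pos) auto
    then have "\<gamma> < p * f k0 + q * (c k0 + d)" by (intro below[OF k0]) auto
    moreover have "q * d = - \<bar>p * f k0 + q * c k0 - \<gamma>\<bar>" using \<open>q < 0\<close> by (simp add: d_def)
    ultimately show False by (simp add: distrib_left)
  qed
  show ?thesis
  proof (cases "p = 0")
    case False
    then have "p < 0" using p by simp
    have "f k + (q / - p) * (\<epsilon> - c k) \<le> v" if "k \<in> K" for k
    proof -
      have "p * v + q * \<epsilon> < p * f k + q * c k"
        using sep below[OF that order_refl order_refl] by linarith
      then have "(- p) * (f k + (q / - p) * (\<epsilon> - c k)) \<le> (- p) * v"
        using \<open>p < 0\<close> by (simp add: algebra_simps)
      then show ?thesis using \<open>p < 0\<close> by (simp only: mult_le_cancel_left_pos neg_0_less_iff_less)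
    qed
    moreover have "q / - p \<ge> 0" using \<open>p < 0\<close> q by (intro divide_nonneg_pos) auto
    ultimately show ?thesis by blast
  next
    \<comment> \<open>If the normal has no first component, the constraint is violated by a positive margin on K.\<close>
    case True
    then have "q \<noteq> 0" using sep below[OF k0 order_refl order_refl] by auto
    then have "q > 0" using q by simp
    define \<delta> where "\<delta> = (\<gamma> - q * \<epsilon>) / q"
    have "\<delta> > 0" using sep \<open>q > 0\<close> True by (simp add: \<delta>_def)
    have viol: "c k - \<epsilon> \<ge> \<delta>" if "k \<in> K" for k
      using below[OF that order_refl order_refl] \<open>q > 0\<close> True by (simp add: \<delta>_def field_simps)
    obtain k1 where k1: "\<And>k. k \<in> K \<Longrightarrow> f k \<le> f k1"
      using continuous_attains_sup[OF K \<open>K \<noteq> {}\<close> f] by auto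
    define u where "u = \<bar>f k1 - v\<bar> / \<delta>"
    have "u \<ge> 0" using \<open>\<delta> > 0\<close> by (simp add: u_def)
    have "f k + u * (\<epsilon> - c k) \<le> v" if "k \<in> K" for k
    proof -
      have "u * (\<epsilon> - c k) \<le> u * (- \<delta>)"
        using viol[OF that] \<open>u \<ge> 0\<close> by (intro mult_left_mono) auto
      moreover have "u * \<delta> = \<bar>f k1 - v\<bar>" using \<open>\<delta> > 0\<close> by (simp add: u_def)
      ultimately show ?thesis using k1[OF that] by simp
    qed
    then show ?thesis using \<open>u \<ge> 0\<close> by blast
  qed
qed

text \<open>
  The topology is that of the product over the whole index type; outside I the extensional functions
  have the single value undefined, so Tychonoff's theorem applies to all coordinates.
\<close>

lemma compact_PiE_UNIV_topology:
  fixes S :: "'i \<Rightarrow> 'a::topological_space set"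
  assumes "\<And>i. i \<in> I \<Longrightarrow> compact (S i)"
  shows "compact (PiE I S)"
proof -
  let ?S = "\<lambda>i. if i \<in> I then S i else {undefined}"
  have "compactin (product_topology (\<lambda>_. euclidean) UNIV) (PiE UNIV ?S)"
    unfolding compactin_PiE using assms by auto
  moreover have "PiE UNIV ?S = PiE I S"
    by (auto simp: PiE_def Pi_def extensional_def split: if_splits)
  ultimately show ?thesis by (simp add: euclidean_product_topology)
qed

text \<open>
  A multiplier for maximizing a weighted sum of values of one concave function, subject to a bound
  on the transport cost to the points \<open>r i\<close> with the same weight. The tuples are restricted to extensional functions on I, which form a compact set in the product topology.
\<close>

lemma transport_lagrange_multiplier:
  fixes g :: "'a::euclidean_space \<Rightarrow> real" and r :: "'i \<Rightarrow> 'a"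
  assumes "compact \<Xi>" "convex \<Xi>" and g: "concave_on UNIV g" and "w \<ge> 0"
    and less: "\<And>\<xi>. \<forall>i\<in>I. \<xi> i \<in> \<Xi> \<Longrightarrow> w * (\<Sum>i\<in>I. (norm (\<xi> i - r i))\<^sup>2) \<le> \<epsilon> \<Longrightarrow>
      w * (\<Sum>i\<in>I. g (\<xi> i)) < v"
  shows "\<exists>u\<ge>0. \<forall>\<xi>. (\<forall>i\<in>I. \<xi> i \<in> \<Xi>) \<longrightarrow>
    u * \<epsilon> + w * (\<Sum>i\<in>I. g (\<xi> i) - u * (norm (\<xi> i - r i))\<^sup>2) \<le> v"
proof -
  define f where "f \<xi> = w * (\<Sum>i\<in>I. g (\<xi> i))" for \<xi> :: "'i \<Rightarrow> 'a"
  define c where "c \<xi> = w * (\<Sum>i\<in>I. (norm (\<xi> i - r i))\<^sup>2)" for \<xi> :: "'i \<Rightarrow> 'a"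
  define K where "K = PiE I (\<lambda>_. \<Xi>)"
  have coord: "continuous_on K (\<lambda>\<xi>. \<xi> i)" for i
    by (rule continuous_on_subset[OF continuous_on_product_coordinates subset_UNIV])
  have gc: "continuous_on UNIV g" using g by (rule concave_on_UNIV_imp_continuous)
  have "\<exists>u\<ge>0. \<forall>k\<in>K. f k + u * (\<epsilon> - c k) \<le> v"
  proof (rule convexlike_lagrange_multiplier)
    show "compact K" unfolding K_def using assms(1) by (rule compact_PiE_UNIV_topology)
    show "continuous_on K f" unfolding f_def
      by (intro continuous_intros continuous_on_compose2[OF gc coord]) auto
    show "continuous_on K c" unfolding c_def
      by (intro continuous_intros coord)
    show "f k < v" if "k \<in> K" "c k \<le> \<epsilon>" for k
      using less[of k] that by (auto simp: K_def f_def c_def)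
    show "\<exists>m\<in>K. (1 - t) * f k + t * f l \<le> f m \<and> c m \<le> (1 - t) * c k + t * c l"
      if kl: "k \<in> K" "l \<in> K" and t: "t \<in> {0..1}" for k l t
    proof
      define m where "m = restrict (\<lambda>i. (1 - t) *\<^sub>R k i + t *\<^sub>R l i) I"
      show "m \<in> K"
        using kl t \<open>convex \<Xi>\<close> by (auto simp: m_def K_def convex_alt PiE_def Pi_def)
      have "(1 - t) * f k + t * f l = w * (\<Sum>i\<in>I. (1 - t) * g (k i) + t * g (l i))"
        unfolding f_def sum.distrib sum_distrib_left[symmetric] by (simp add: algebra_simps)
      also have "\<dots> \<le> f m"
        unfolding f_def
      proof (intro mult_left_mono sum_mono \<open>w \<ge> 0\<close>)
        show "(1 - t) * g (k i) + t * g (l i) \<le> g (m i)" if "i \<in> I" for i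
          using concave_onD[OF g, of t "k i" "l i"] t that by (simp add: m_def)
      qed
      finally have 1: "(1 - t) * f k + t * f l \<le> f m" .
      have "c m \<le> w * (\<Sum>i\<in>I. (1 - t) * (norm (k i - r i))\<^sup>2 + t * (norm (l i - r i))\<^sup>2)"
        unfolding c_def
      proof (intro mult_left_mono sum_mono \<open>w \<ge> 0\<close>)
        show "(norm (m i - r i))\<^sup>2 \<le> (1 - t) * (norm (k i - r i))\<^sup>2 + t * (norm (l i - r i))\<^sup>2"
          if "i \<in> I" for i
        proof -
          have "m i - r i = (1 - t) *\<^sub>R (k i - r i) + t *\<^sub>R (l i - r i)"
            using that by (simp add: m_def algebra_simps)
          then show ?thesis using convex_norm_power2[OF t] by simp
        qed
      qed
      also have "\<dots> = (1 - t) * c k + t * c l"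
        unfolding c_def sum.distrib sum_distrib_left[symmetric] by (simp add: algebra_simps)
      finally show "(1 - t) * f k + t * f l \<le> f m \<and> c m \<le> (1 - t) * c k + t * c l"
        using 1 by simp
    qed
  qed
  then obtain u where u: "u \<ge> 0" "\<And>k. k \<in> K \<Longrightarrow> f k + u * (\<epsilon> - c k) \<le> v" by blast
  have "u * \<epsilon> + w * (\<Sum>i\<in>I. g (\<xi> i) - u * (norm (\<xi> i - r i))\<^sup>2) \<le> v" if "\<forall>i\<in>I. \<xi> i \<in> \<Xi>" for \<xi>
  proof -
    have "restrict \<xi> I \<in> K" using that by (auto simp: K_def)
    moreover have "f (restrict \<xi> I) = f \<xi>" "c (restrict \<xi> I) = c \<xi>"
      by (simp_all add: f_def c_def)
    ultimately have "f \<xi> + u * (\<epsilon> - c \<xi>) \<le> v"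
      using u(2)[of "restrict \<xi> I"] by simp
    then show ?thesis
      unfolding f_def c_def sum_subtractf sum_distrib_left[symmetric] by (simp add: algebra_simps)
  qed
  then show ?thesis using u(1) by blast
qed

section \<open>Couplings with a finitely supported distribution\<close>

lemma near_optimal_coupling:
  assumes "(wasserstein2 P Q)\<^sup>2 \<le> ennreal \<epsilon>" "\<epsilon> \<ge> 0" "\<delta> > 0"
  shows "\<exists>\<pi>\<in>couplings P Q. (\<integral>\<^sup>+ (\<xi>, \<xi>'). ennreal ((norm (\<xi> - \<xi>'))\<^sup>2) \<partial>\<pi>) \<le> ennreal (\<epsilon> + \<delta>)"
proof -
  have "wasserstein2 P Q < ennreal (sqrt (\<epsilon> + \<delta>))"
  proof (rule ccontr)
    assume "\<not> ?thesis"
    then have "(ennreal (sqrt (\<epsilon> + \<delta>)))\<^sup>2 \<le> (wasserstein2 P Q)\<^sup>2"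
      by (intro power_mono) auto
    also note assms(1)
    finally show False using assms(2,3) by (simp add: ennreal_power)
  qed
  then obtain \<pi> where \<pi>: "\<pi> \<in> couplings P Q"
    and less: "ennreal_sqrt (\<integral>\<^sup>+ (\<xi>, \<xi>'). ennreal ((norm (\<xi> - \<xi>'))\<^sup>2) \<partial>\<pi>) < ennreal (sqrt (\<epsilon> + \<delta>))"
    unfolding wasserstein2_def INF_less_iff by blast
  have "C \<le> ennreal (\<epsilon> + \<delta>)" if "ennreal_sqrt C < ennreal (sqrt (\<epsilon> + \<delta>))" for C
    using that assms(2,3) by (cases C)
      (auto simp: ennreal_sqrt_def ennreal_less_iff simp del: ennreal_plus intro!: ennreal_leI)
  with \<pi> less show ?thesis by blast
qed

text \<open>
  The reference distribution has equal mass at each \<open>r i\<close>. Almost all second coordinates under a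
  coupling are among these points, so the maximum of g minus u times the transport cost is
  needed there only, and no measurable selection of maximizers has to be made.
\<close>

lemma weak_duality_transport:
  fixes g :: "'a::euclidean_space \<Rightarrow> real" and r :: "'i \<Rightarrow> 'a"
  assumes I: "finite I" "I \<noteq> {}" and \<Xi>: "compact \<Xi>" and g: "continuous_on UNIV g"
    and F: "F \<in> distributions_on \<Xi>" and "u \<ge> 0" "\<epsilon> \<ge> 0"
    and W: "(wasserstein2 F (distr (uniform_count_measure I) borel r))\<^sup>2 \<le> ennreal \<epsilon>"
  shows "\<exists>\<xi>. (\<forall>i\<in>I. \<xi> i \<in> \<Xi>) \<and>
    (\<integral>z. g z \<partial>F) \<le> u * \<epsilon> + 1 / real (card I) * (\<Sum>i\<in>I. g (\<xi> i) - u * (norm (\<xi> i - r i))\<^sup>2)"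
proof -
  let ?U = "uniform_count_measure I"
  interpret F: prob_space F using F by (simp add: distributions_on_def)
  have sF[measurable_cong]: "sets F = sets borel" and F1: "emeasure F \<Xi> = 1"
    using F by (auto simp: distributions_on_def)
  have [measurable]: "g \<in> borel_measurable borel" using g by (rule borel_measurable_continuous_onI)
  have r[measurable]: "r \<in> measurable ?U borel"
    by (simp add: measurable_def space_uniform_count_measure sets_uniform_count_measure)
  have "\<Xi> \<noteq> {}" using F1 by auto
  have "\<exists>m\<in>\<Xi>. \<forall>z\<in>\<Xi>. g z - u * (norm (z - s))\<^sup>2 \<le> g m - u * (norm (m - s))\<^sup>2" for s
    by (intro continuous_attains_sup \<Xi> \<open>\<Xi> \<noteq> {}\<close> continuous_intros continuous_on_subset[OF g]) auto
  then obtain m where m: "\<And>s. m s \<in> \<Xi>"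
    and max: "\<And>s z. z \<in> \<Xi> \<Longrightarrow> g z - u * (norm (z - s))\<^sup>2 \<le> g (m s) - u * (norm (m s - s))\<^sup>2"
    by metis
  \<comment> \<open>\<open>\<phi>\<close> is the maximum at the atoms \<open>r i\<close> and 0 elsewhere, so that it is measurable.\<close>
  define \<phi> where "\<phi> s = (\<Sum>q\<in>r ` I. (g (m q) - u * (norm (m q - q))\<^sup>2) * indicator {q} s)" for s
  have \<phi>: "\<phi> s = g (m s) - u * (norm (m s - s))\<^sup>2" if "s \<in> r ` I" for s
    unfolding \<phi>_def using that I
    by (subst sum.remove[of _ s]) (auto intro!: sum.neutral simp: indicator_def)
  have [measurable]: "\<phi> \<in> borel_measurable borel" unfolding \<phi>_def by measurable
  obtain B where B: "\<And>z. z \<in> \<Xi> \<Longrightarrow> norm (g z) \<le> B"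
    using compact_imp_bounded[OF compact_continuous_image[OF continuous_on_subset[OF g] \<Xi>]]
    by (auto simp: bounded_iff)
  have "closed \<Xi>" using \<Xi> by (rule compact_imp_closed)
  then have [measurable]: "\<Xi> \<in> sets borel" by simp
  have aeF: "AE z in F. z \<in> \<Xi>"
    using F1 by (intro F.AE_prob_1) (simp add: F.emeasure_eq_measure)
  define R where "R = 1 / real (card I) * (\<Sum>i\<in>I. g (m (r i)) - u * (norm (m (r i) - r i))\<^sup>2)"
  \<comment> \<open>A coupling within \<open>\<delta>\<close> of the bound suffices; no optimal coupling is needed.\<close>
  have approx: "(\<integral>z. g z \<partial>F) \<le> R + u * (\<epsilon> + \<delta>)" if \<delta>: "\<delta> > 0" for \<delta>
  proof -
    obtain \<pi> where \<pi>: "\<pi> \<in> couplings F (distr ?U borel r)"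
      and cost: "(\<integral>\<^sup>+ (\<xi>, \<xi>'). ennreal ((norm (\<xi> - \<xi>'))\<^sup>2) \<partial>\<pi>) \<le> ennreal (\<epsilon> + \<delta>)"
      using near_optimal_coupling[OF W \<open>\<epsilon> \<ge> 0\<close> \<delta>] by blast
    have s\<pi>[measurable_cong]: "sets \<pi> = sets (borel \<Otimes>\<^sub>M borel)"
      and d1: "distr \<pi> borel fst = F" and d2: "distr \<pi> borel snd = distr ?U borel r"
      and "prob_space \<pi>"
      using \<pi> by (auto simp: couplings_def)
    interpret \<pi>: prob_space \<pi> by fact
    let ?c = "\<lambda>p. (norm (fst p - snd p))\<^sup>2 :: real"
    have cost': "(\<integral>\<^sup>+ p. ennreal (?c p) \<partial>\<pi>) \<le> ennreal (\<epsilon> + \<delta>)"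
      using cost by (simp add: case_prod_beta' del: ennreal_plus)
    have ic: "integrable \<pi> ?c"
      by (rule integrableI_nonneg) (use order_le_less_trans[OF cost' ennreal_less_top] in auto)
    have "ennreal (\<integral>p. ?c p \<partial>\<pi>) \<le> ennreal (\<epsilon> + \<delta>)"
      using cost' by (subst (asm) nn_integral_eq_integral[OF ic]) auto
    then have c_le: "(\<integral>p. ?c p \<partial>\<pi>) \<le> \<epsilon> + \<delta>" using \<open>\<epsilon> \<ge> 0\<close> \<delta> by (simp del: ennreal_plus)
    have ae1: "AE p in \<pi>. fst p \<in> \<Xi>"
      using aeF unfolding d1[symmetric] by (intro AE_distrD[of fst _ borel "\<lambda>z. z \<in> \<Xi>"]) auto
    have "AE s in distr ?U borel r. s \<in> r ` I"
      using I by (subst AE_distr_iff)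
        (auto simp: space_uniform_count_measure finite_imp_closed intro!: AE_I2)
    then have ae2: "AE p in \<pi>. snd p \<in> r ` I"
      unfolding d2[symmetric] by (intro AE_distrD[of snd _ borel "\<lambda>s. s \<in> r ` I"]) auto
    have ig: "integrable \<pi> (\<lambda>p. g (fst p))"
      by (rule \<pi>.integrable_const_bound[of _ B]) (use ae1 B in \<open>auto elim: AE_mp\<close>)
    obtain B' where B': "\<And>s. s \<in> r ` I \<Longrightarrow> norm (\<phi> s) \<le> B'"
      using finite_imp_bounded[of "\<phi> ` (r ` I)"] I by (auto simp: bounded_iff)
    have i\<phi>: "integrable \<pi> (\<lambda>p. \<phi> (snd p))"
      by (rule \<pi>.integrable_const_bound[of _ B']) (use ae2 B' in \<open>auto elim: AE_mp\<close>)
    have "(\<integral>z. g z \<partial>F) = (\<integral>p. g (fst p) \<partial>\<pi>)"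
      unfolding d1[symmetric] by (rule integral_distr) auto
    also have "\<dots> \<le> (\<integral>p. \<phi> (snd p) + u * ?c p \<partial>\<pi>)"
    proof (rule integral_mono_AE)
      show "AE p in \<pi>. g (fst p) \<le> \<phi> (snd p) + u * ?c p"
        using ae1 ae2
      proof eventually_elim
        case (elim p)
        then show ?case using max[of "fst p" "snd p"] \<phi>[of "snd p"] by simp
      qed
    qed (use ig i\<phi> ic in auto)
    also have "\<dots> = (\<integral>p. \<phi> (snd p) \<partial>\<pi>) + u * (\<integral>p. ?c p \<partial>\<pi>)"
      using i\<phi> ic by simp
    also have "(\<integral>p. \<phi> (snd p) \<partial>\<pi>) = (\<integral>s. \<phi> s \<partial>distr ?U borel r)"
      unfolding d2[symmetric] by (rule integral_distr[symmetric]) auto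
    also have "\<dots> = (\<integral>i. \<phi> (r i) \<partial>?U)"
      by (rule integral_distr) auto
    also have "\<dots> = R"
      using I(1) \<phi> by (simp add: integral_uniform_count_measure R_def)
    also have "R + u * (\<integral>p. ?c p \<partial>\<pi>) \<le> R + u * (\<epsilon> + \<delta>)"
      using c_le \<open>u \<ge> 0\<close> by (simp add: mult_left_mono)
    finally show ?thesis .
  qed
  have "(\<integral>z. g z \<partial>F) \<le> R + u * \<epsilon>"
  proof (rule field_le_epsilon)
    fix e :: real assume "e > 0"
    \<comment> \<open>The denominator \<open>u + 1\<close> also covers \<open>u = 0\<close>.\<close>
    have "u * (e / (u + 1)) \<le> e" using \<open>u \<ge> 0\<close> \<open>e > 0\<close> by (simp add: field_simps)
    with approx[of "e / (u + 1)"] \<open>u \<ge> 0\<close> \<open>e > 0\<close> show "(\<integral>z. g z \<partial>F) \<le> R + u * \<epsilon> + e"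
      by (simp add: distrib_left)
  qed
  then show ?thesis
    using m by (intro exI[of _ "\<lambda>i. m (r i)"]) (simp add: R_def)
qed

text \<open>The coupling pairs \<open>\<xi> i\<close> with \<open>r i\<close>; the points need not be distinct.\<close>

lemma wasserstein2_atoms_le:
  fixes \<xi> r :: "'i \<Rightarrow> 'a::euclidean_space"
  assumes I: "finite I" "I \<noteq> {}"
    and cost: "1 / real (card I) * (\<Sum>i\<in>I. (norm (\<xi> i - r i))\<^sup>2) \<le> \<epsilon>"
  shows "(wasserstein2 (distr (uniform_count_measure I) borel \<xi>)
    (distr (uniform_count_measure I) borel r))\<^sup>2 \<le> ennreal \<epsilon>"
proof -
  let ?U = "uniform_count_measure I"
  interpret prob_space ?U using I by (rule prob_space_uniform_count_measure)
  have [measurable]: "f \<in> measurable ?U borel" for f :: "'i \<Rightarrow> 'a"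
    by (simp add: measurable_def space_uniform_count_measure sets_uniform_count_measure)
  define \<pi> where "\<pi> = distr ?U (borel \<Otimes>\<^sub>M borel) (\<lambda>i. (\<xi> i, r i))"
  define k where "k = 1 / real (card I) * (\<Sum>i\<in>I. (norm (\<xi> i - r i))\<^sup>2)"
  have "k \<ge> 0" unfolding k_def by (simp add: sum_nonneg)
  have "\<pi> \<in> couplings (distr ?U borel \<xi>) (distr ?U borel r)"
    unfolding couplings_def \<pi>_def by (auto simp: distr_distr o_def intro!: prob_space_distr)
  moreover have "(\<integral>\<^sup>+ (\<xi>, \<xi>'). ennreal ((norm (\<xi> - \<xi>'))\<^sup>2) \<partial>\<pi>) = ennreal k"
  proof -
    have "(\<integral>\<^sup>+ (\<xi>, \<xi>'). ennreal ((norm (\<xi> - \<xi>'))\<^sup>2) \<partial>\<pi>)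
        = (\<integral>\<^sup>+ i. ennreal ((norm (\<xi> i - r i))\<^sup>2) \<partial>?U)"
      unfolding \<pi>_def by (subst nn_integral_distr) auto
    also have "\<dots> = (\<Sum>i\<in>I. ennreal (1 / real (card I)) * ennreal ((norm (\<xi> i - r i))\<^sup>2))"
      unfolding uniform_count_measure_def using I(1) by (simp add: nn_integral_point_measure_finite)
    also have "\<dots> = (\<Sum>i\<in>I. ennreal (1 / real (card I) * (norm (\<xi> i - r i))\<^sup>2))"
      by (intro sum.cong refl ennreal_mult[symmetric]) auto
    also have "\<dots> = ennreal k"
      by (subst sum_ennreal) (auto simp: k_def sum_distrib_left)
    finally show ?thesis .
  qed
  moreover have "ennreal_sqrt (ennreal k) = ennreal (sqrt k)"
    using \<open>k \<ge> 0\<close> by (simp add: ennreal_sqrt_def)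
  ultimately have "wasserstein2 (distr ?U borel \<xi>) (distr ?U borel r) \<le> ennreal (sqrt k)"
    unfolding wasserstein2_def by (intro INF_lower2[of \<pi>]) auto
  then have "(wasserstein2 (distr ?U borel \<xi>) (distr ?U borel r))\<^sup>2 \<le> (ennreal (sqrt k))\<^sup>2"
    by (intro power_mono) auto
  also have "\<dots> = ennreal k" using \<open>k \<ge> 0\<close> by (simp add: ennreal_power)
  also have "\<dots> \<le> ennreal \<epsilon>" using cost by (intro ennreal_leI) (simp add: k_def)
  finally show ?thesis .
qed

lemma distr_atoms_in_distributions_on:
  fixes \<xi> :: "'i \<Rightarrow> 'a::euclidean_space"
  assumes I: "finite I" "I \<noteq> {}" and "closed \<Xi>" "\<forall>i\<in>I. \<xi> i \<in> \<Xi>"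
  shows "distr (uniform_count_measure I) borel \<xi> \<in> distributions_on \<Xi>"
proof -
  let ?U = "uniform_count_measure I"
  interpret prob_space ?U using I by (rule prob_space_uniform_count_measure)
  have \<xi>: "\<xi> \<in> measurable ?U borel"
    by (simp add: measurable_def space_uniform_count_measure sets_uniform_count_measure)
  have "\<xi> -` \<Xi> \<inter> space ?U = space ?U"
    using assms by (auto simp: space_uniform_count_measure)
  then have "emeasure (distr ?U borel \<xi>) \<Xi> = 1"
    using assms(3) \<xi> by (subst emeasure_distr) (auto simp: emeasure_space_1)
  then show ?thesis
    using \<xi> by (simp add: distributions_on_def prob_space_distr)
qed

section \<open>The three inner values\<close>

lemma concave_on_translation:
  fixes f :: "'a::real_vector \<Rightarrow> real"
  assumes "concave_on UNIV f"
  shows "concave_on UNIV (\<lambda>z. f (a + z))"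
  unfolding concave_on_iff
proof (intro conjI ballI allI impI)
  fix p q :: 'a and u v :: real
  assume uv: "u \<ge> 0" "v \<ge> 0" "u + v = 1"
  have "a + (u *\<^sub>R p + v *\<^sub>R q) = (u + v) *\<^sub>R a + (u *\<^sub>R p + v *\<^sub>R q)"
    by (simp add: uv(3))
  also have "\<dots> = u *\<^sub>R (a + p) + v *\<^sub>R (a + q)"
    by (simp add: algebra_simps)
  finally show "u * f (a + p) + v * f (a + q) \<le> f (a + (u *\<^sub>R p + v *\<^sub>R q))"
    using assms uv by (simp add: concave_on_iff)
qed simp

lemma minimax_value_le_dro_value:
  assumes "n \<ge> 2" "closed \<Xi>" and h: "concave_on UNIV (h x)"
  shows "minimax_value n y Ahat \<epsilon>\<^sub>1 \<epsilon>\<^sub>2 \<Xi> h x \<le> dro_value n y Ahat \<epsilon>\<^sub>1 \<epsilon>\<^sub>2 \<Xi> h x"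
  unfolding minimax_value_def
proof (rule SUP_least, clarify)
  fix A \<xi> assume "(A, \<xi>) \<in> minimax_feasible n y Ahat \<epsilon>\<^sub>1 \<epsilon>\<^sub>2 \<Xi>"
  moreover have I: "{1..n - 1} = {1..<n}" "card {1..<n} = n - 1" "{1..<n} \<noteq> {}"
    using assms(1) by auto
  ultimately have \<xi>: "\<forall>i\<in>{1..<n}. \<xi> i \<in> \<Xi>" and A: "A \<in> Omega_set Ahat \<epsilon>\<^sub>2"
    and cost: "1 / real (card {1..<n}) * (\<Sum>i\<in>{1..<n}. (norm (\<xi> i - residual y A i))\<^sup>2) \<le> \<epsilon>\<^sub>1"
    by (simp_all add: minimax_feasible_def Omega_set_def residual_def)
  let ?F = "distr (uniform_count_measure {1..<n}) borel \<xi>"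
  have m: "\<xi> \<in> measurable (uniform_count_measure {1..<n}) borel"
    by (simp add: measurable_def space_uniform_count_measure sets_uniform_count_measure)
  have "continuous_on UNIV (\<lambda>z. h x (A *v y n + z))"
    by (intro concave_on_UNIV_imp_continuous concave_on_translation h)
  then have "(\<lambda>z. h x (A *v y n + z)) \<in> borel_measurable borel"
    by (rule borel_measurable_continuous_onI)
  then have "minimax_objective n y h x A \<xi> = (\<integral>z. h x (A *v y n + z) \<partial>?F)"
    using I by (subst integral_distr[OF m])
      (simp_all add: integral_uniform_count_measure minimax_objective_def)
  moreover have "?F \<in> distributions_on \<Xi>"
    using I \<xi> assms(2) by (intro distr_atoms_in_distributions_on) auto
  moreover have "(wasserstein2 ?F (empirical_dist n y A))\<^sup>2 \<le> ennreal \<epsilon>\<^sub>1"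
    unfolding empirical_dist_def using I cost by (intro wasserstein2_atoms_le) auto
  ultimately show "ereal (minimax_objective n y h x A \<xi>) \<le> dro_value n y Ahat \<epsilon>\<^sub>1 \<epsilon>\<^sub>2 \<Xi> h x"
    unfolding dro_value_def using A by (intro SUP_upper2[of "(A, ?F)"]) auto
qed

lemma dro_value_le_dual_value:
  assumes "n \<ge> 2" "\<epsilon>\<^sub>1 \<ge> 0" "compact \<Xi>" and h: "concave_on UNIV (h x)"
  shows "dro_value n y Ahat \<epsilon>\<^sub>1 \<epsilon>\<^sub>2 \<Xi> h x \<le> dual_value n y Ahat \<epsilon>\<^sub>1 \<epsilon>\<^sub>2 \<Xi> h x"
  unfolding dro_value_def
proof (rule SUP_least, clarify)
  fix A F
  assume A: "A \<in> Omega_set Ahat \<epsilon>\<^sub>2" and F: "F \<in> distributions_on \<Xi>"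
    and W: "(wasserstein2 F (empirical_dist n y A))\<^sup>2 \<le> ennreal \<epsilon>\<^sub>1"
  have I: "{1..n - 1} = {1..<n}" "card {1..<n} = n - 1" "{1..<n} \<noteq> {}"
    using assms(1) by auto
  show "ereal (\<integral>z. h x (A *v y n + z) \<partial>F) \<le> dual_value n y Ahat \<epsilon>\<^sub>1 \<epsilon>\<^sub>2 \<Xi> h x"
    unfolding dual_value_def
  proof (intro SUP_upper2[OF A] INF_greatest)
    fix u :: real assume "u \<in> {0..}"
    then obtain \<xi> where "\<forall>i\<in>{1..<n}. \<xi> i \<in> \<Xi>"
      and "(\<integral>z. h x (A *v y n + z) \<partial>F) \<le> u * \<epsilon>\<^sub>1 + 1 / real (card {1..<n}) *
        (\<Sum>i\<in>{1..<n}. h x (A *v y n + \<xi> i) - u * (norm (\<xi> i - residual y A i))\<^sup>2)"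
      using weak_duality_transport[of "{1..<n}" \<Xi> "\<lambda>z. h x (A *v y n + z)" F u \<epsilon>\<^sub>1 "residual y A"]
        I assms(2,3) F W[unfolded empirical_dist_def]
        concave_on_UNIV_imp_continuous[OF concave_on_translation[OF h]]
      by auto
    then show "ereal (\<integral>z. h x (A *v y n + z) \<partial>F) \<le>
      (SUP \<xi> \<in> {\<xi>. \<forall>i\<in>{1..<n}. \<xi> i \<in> \<Xi>}. ereal (u * \<epsilon>\<^sub>1 + 1 / real (n - 1) *
        (\<Sum>i = 1..n - 1. h x (A *v y n + \<xi> i) - u * (norm (\<xi> i - (y (i + 1) - A *v y i)))\<^sup>2)))"
      using I by (intro SUP_upper2[of \<xi>]) (auto simp: residual_def)
  qed
qed

lemma dual_value_le_minimax_value: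
  assumes "n \<ge> 2" "compact \<Xi>" "convex \<Xi>" and h: "concave_on UNIV (h x)"
  shows "dual_value n y Ahat \<epsilon>\<^sub>1 \<epsilon>\<^sub>2 \<Xi> h x \<le> minimax_value n y Ahat \<epsilon>\<^sub>1 \<epsilon>\<^sub>2 \<Xi> h x"
  unfolding dual_value_def
proof (rule SUP_least, rule dense_ge)
  fix A z
  assume A: "A \<in> Omega_set Ahat \<epsilon>\<^sub>2" and z: "minimax_value n y Ahat \<epsilon>\<^sub>1 \<epsilon>\<^sub>2 \<Xi> h x < z"
  have I: "{1..n - 1} = {1..<n}" using assms(1) by auto
  show "(INF u\<in>{0..}. SUP \<xi>\<in>{\<xi>. \<forall>i\<in>{1..<n}. \<xi> i \<in> \<Xi>}. ereal (u * \<epsilon>\<^sub>1 + 1 / real (n - 1) *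
      (\<Sum>i = 1..n - 1. h x (A *v y n + \<xi> i) - u * (norm (\<xi> i - (y (i + 1) - A *v y i)))\<^sup>2))) \<le> z"
  proof (cases z)
    \<comment> \<open>If the minimax problem is infeasible, v is any real number, and the dual value is
      minus infinity.\<close>
    case (real v)
    have "\<exists>u\<ge>0. \<forall>\<xi>. (\<forall>i\<in>{1..<n}. \<xi> i \<in> \<Xi>) \<longrightarrow> u * \<epsilon>\<^sub>1 + 1 / real (n - 1) *
      (\<Sum>i = 1..<n. h x (A *v y n + \<xi> i) - u * (norm (\<xi> i - residual y A i))\<^sup>2) \<le> v"
    proof (rule transport_lagrange_multiplier)
      fix \<xi> assume "\<forall>i\<in>{1..<n}. \<xi> i \<in> \<Xi>"
        "1 / real (n - 1) * (\<Sum>i = 1..<n. (norm (\<xi> i - residual y A i))\<^sup>2) \<le> \<epsilon>\<^sub>1"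
      then have "(A, \<xi>) \<in> minimax_feasible n y Ahat \<epsilon>\<^sub>1 \<epsilon>\<^sub>2 \<Xi>"
        using A I by (simp add: minimax_feasible_def Omega_set_def residual_def)
      then have "ereal (minimax_objective n y h x A \<xi>) \<le> minimax_value n y Ahat \<epsilon>\<^sub>1 \<epsilon>\<^sub>2 \<Xi> h x"
        unfolding minimax_value_def by (rule SUP_upper2) simp
      also note z
      finally show "1 / real (n - 1) * (\<Sum>i = 1..<n. h x (A *v y n + \<xi> i)) < v"
        using I real by (simp add: minimax_objective_def)
    qed (use assms concave_on_translation[OF h] in auto)
    then obtain u where "u \<ge> 0" and "\<And>\<xi>. \<forall>i\<in>{1..<n}. \<xi> i \<in> \<Xi> \<Longrightarrow> u * \<epsilon>\<^sub>1 + 1 / real (n - 1) *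
      (\<Sum>i = 1..<n. h x (A *v y n + \<xi> i) - u * (norm (\<xi> i - residual y A i))\<^sup>2) \<le> v"
      by blast
    then show ?thesis
      using I real by (intro INF_lower2[of u] SUP_least) (auto simp: residual_def)
  qed (use z in auto)
qed

section \<open>Convexity of the minimax problem\<close>

lemma convex_on_minimax_objective:
  assumes "convex D" and h: "\<And>z. convex_on D (\<lambda>x. h x z)"
  shows "convex_on D (\<lambda>x. minimax_objective n y h x A \<xi>)"
  unfolding convex_on_def
proof (intro conjI ballI allI impI assms(1))
  fix p q u v assume pq: "p \<in> D" "q \<in> D" and uv: "0 \<le> u" "0 \<le> v" "u + v = (1::real)"
  have "minimax_objective n y h (u *\<^sub>R p + v *\<^sub>R q) A \<xi>
      \<le> 1 / real (n - 1) * (\<Sum>i = 1..n - 1. u * h p (A *v y n + \<xi> i) + v * h q (A *v y n + \<xi> i))"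
    unfolding minimax_objective_def
    by (intro mult_left_mono sum_mono) (use h pq uv in \<open>auto simp: convex_on_def\<close>)
  also have "\<dots> = u * minimax_objective n y h p A \<xi> + v * minimax_objective n y h q A \<xi>"
    by (simp add: minimax_objective_def sum.distrib sum_distrib_left[symmetric] add_divide_distrib)
  finally show "minimax_objective n y h (u *\<^sub>R p + v *\<^sub>R q) A \<xi>
    \<le> u * minimax_objective n y h p A \<xi> + v * minimax_objective n y h q A \<xi>" .
qed

lemma convex_combination_affine_matrix:
  fixes A B :: "real^'n^'m"
  shows "((1 - t) *\<^sub>R A + t *\<^sub>R B) *v z + ((1 - t) *\<^sub>R p + t *\<^sub>R q)
    = (1 - t) *\<^sub>R (A *v z + p) + t *\<^sub>R (B *v z + q)"
  by (simp add: matrix_vector_mult_add_rdistrib scaleR_matrix_vector_assoc[symmetric]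
      scaleR_add_right algebra_simps)

lemma jointly_concave_minimax_objective:
  assumes h: "concave_on UNIV (h x)"
  shows "jointly_concave (\<lambda>A \<xi>. minimax_objective n y h x A \<xi>)"
  unfolding jointly_concave_def
proof (intro allI ballI)
  fix A \<xi> B \<eta> and t :: real assume t: "t \<in> {0..1}"
  have "(1 - t) * minimax_objective n y h x A \<xi> + t * minimax_objective n y h x B \<eta>
    = 1 / real (n - 1) * (\<Sum>i = 1..n - 1. (1 - t) * h x (A *v y n + \<xi> i) + t * h x (B *v y n + \<eta> i))"
    by (simp add: minimax_objective_def sum.distrib sum_distrib_left[symmetric] add_divide_distrib)
  also have "\<dots> \<le> minimax_objective n y h x ((1 - t) *\<^sub>R A + t *\<^sub>R B) (\<lambda>i. (1 - t) *\<^sub>R \<xi> i + t *\<^sub>R \<eta> i)"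
    unfolding minimax_objective_def convex_combination_affine_matrix
    by (intro mult_left_mono sum_mono concave_onD[OF h]) (use t in auto)
  finally show "(1 - t) * minimax_objective n y h x A \<xi> + t * minimax_objective n y h x B \<eta>
    \<le> minimax_objective n y h x ((1 - t) *\<^sub>R A + t *\<^sub>R B) (\<lambda>i. (1 - t) *\<^sub>R \<xi> i + t *\<^sub>R \<eta> i)" .
qed

lemma jointly_convex_set_minimax_feasible:
  assumes "convex \<Xi>"
  shows "jointly_convex_set (minimax_feasible n y Ahat \<epsilon>\<^sub>1 \<epsilon>\<^sub>2 \<Xi>)"
  unfolding jointly_convex_set_def
proof (clarify)
  fix A \<xi> B \<eta> and t :: real
  assume A: "(A, \<xi>) \<in> minimax_feasible n y Ahat \<epsilon>\<^sub>1 \<epsilon>\<^sub>2 \<Xi>"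
    and B: "(B, \<eta>) \<in> minimax_feasible n y Ahat \<epsilon>\<^sub>1 \<epsilon>\<^sub>2 \<Xi>" and t: "t \<in> {0..1}"
  let ?C = "(1 - t) *\<^sub>R A + t *\<^sub>R B" and ?\<zeta> = "\<lambda>i. (1 - t) *\<^sub>R \<xi> i + t *\<^sub>R \<eta> i"
  let ?cost = "\<lambda>A \<xi>. 1 / real (n - 1) * (\<Sum>i = 1..n - 1. (norm (\<xi> i - (y (i + 1) - A *v y i)))\<^sup>2)"
  have below: "(1 - t) * a + t * b \<le> e" if "a \<le> e" "b \<le> e" for a b e :: real
    using that t convex_bound_le[of a e b "1 - t" t] by simp
  have "?cost ?C ?\<zeta> \<le> 1 / real (n - 1) * (\<Sum>i = 1..n - 1.
      (1 - t) * (norm (\<xi> i - (y (i + 1) - A *v y i)))\<^sup>2 + t * (norm (\<eta> i - (y (i + 1) - B *v y i)))\<^sup>2)"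
  proof (intro mult_left_mono sum_mono)
    fix i
    have "?\<zeta> i - (y (i + 1) - ?C *v y i)
      = (1 - t) *\<^sub>R (\<xi> i - (y (i + 1) - A *v y i)) + t *\<^sub>R (\<eta> i - (y (i + 1) - B *v y i))"
      using convex_combination_affine_matrix[of t A B "y i" "\<xi> i" "\<eta> i"] by (simp add: algebra_simps)
    then show "(norm (?\<zeta> i - (y (i + 1) - ?C *v y i)))\<^sup>2 \<le> (1 - t) * (norm (\<xi> i - (y (i + 1) - A *v y i)))\<^sup>2
      + t * (norm (\<eta> i - (y (i + 1) - B *v y i)))\<^sup>2"
      using convex_norm_power2[OF t] by (simp only:)
  qed simp
  also have "\<dots> = (1 - t) * ?cost A \<xi> + t * ?cost B \<eta>"
    by (simp add: sum.distrib sum_distrib_left[symmetric] add_divide_distrib)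
  also have "\<dots> \<le> \<epsilon>\<^sub>1"
    using A B by (intro below) (auto simp: minimax_feasible_def)
  finally have "?cost ?C ?\<zeta> \<le> \<epsilon>\<^sub>1" .
  moreover have "norm (column i ?C - column i Ahat) \<le> \<epsilon>\<^sub>2 i" for i
  proof -
    have "column i ?C - column i Ahat
        = (1 - t) *\<^sub>R (column i A - column i Ahat) + t *\<^sub>R (column i B - column i Ahat)"
      by (simp add: vec_eq_iff column_def algebra_simps)
    also have "norm \<dots> \<le> (1 - t) * norm (column i A - column i Ahat) + t * norm (column i B - column i Ahat)"
      using t by (intro norm_triangle_le) simp
    also have "\<dots> \<le> \<epsilon>\<^sub>2 i"
      using A B by (intro below) (auto simp: minimax_feasible_def)
    finally show ?thesis .
  qed
  moreover have "\<forall>i\<in>{1..<n}. ?\<zeta> i \<in> \<Xi>"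
    using A B t assms by (auto simp: minimax_feasible_def convex_alt)
  ultimately show "(?C, ?\<zeta>) \<in> minimax_feasible n y Ahat \<epsilon>\<^sub>1 \<epsilon>\<^sub>2 \<Xi>"
    by (simp add: minimax_feasible_def)
qed

section \<open>Equivalence of the three problems\<close>

theorem theorem3p2:
  fixes n :: nat
    and y :: "nat \<Rightarrow> real^'d"
    and Ahat :: "real^'d^'d"
    and \<epsilon>\<^sub>1 :: real
    and \<epsilon>\<^sub>2 :: "'d \<Rightarrow> real"
    and \<Xi> :: "(real^'d) set"
    and D :: "'x::euclidean_space set"
    and h :: "'x \<Rightarrow> real^'d \<Rightarrow> real"
  assumes "n \<ge> 2"
    and "is_regression_estimate n y Ahat"
    and "\<epsilon>\<^sub>1 \<ge> 0" and "\<And>i. \<epsilon>\<^sub>2 i \<ge> 0"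
    and "convex D"
    and "bounded \<Xi>" and "closed \<Xi>" and "convex \<Xi>"
    and "(\<lambda>(x, z). h x z) differentiable_on (D \<times> UNIV)"
    and "\<And>z. convex_on D (\<lambda>x. h x z)"
    and "\<And>x. x \<in> D \<Longrightarrow> concave_on UNIV (\<lambda>z. h x z)"
  shows "(\<forall>x\<in>D. dro_value n y Ahat \<epsilon>\<^sub>1 \<epsilon>\<^sub>2 \<Xi> h x = minimax_value n y Ahat \<epsilon>\<^sub>1 \<epsilon>\<^sub>2 \<Xi> h x
              \<and> dual_value n y Ahat \<epsilon>\<^sub>1 \<epsilon>\<^sub>2 \<Xi> h x = minimax_value n y Ahat \<epsilon>\<^sub>1 \<epsilon>\<^sub>2 \<Xi> h x)
       \<and> (\<forall>A \<xi>. convex_on D (\<lambda>x. minimax_objective n y h x A \<xi>))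
       \<and> (\<forall>x\<in>D. jointly_concave (\<lambda>A \<xi>. minimax_objective n y h x A \<xi>))
       \<and> jointly_convex_set (minimax_feasible n y Ahat \<epsilon>\<^sub>1 \<epsilon>\<^sub>2 \<Xi>)"
proof (intro conjI ballI allI)
  have "compact \<Xi>" using assms(6,7) by (simp add: compact_eq_bounded_closed)
  fix x assume "x \<in> D"
  then have h: "concave_on UNIV (h x)" using assms(11) by simp
  note chain = minimax_value_le_dro_value[where h = h and x = x,
      OF assms(1) \<open>closed \<Xi>\<close> h, of y Ahat \<epsilon>\<^sub>1 \<epsilon>\<^sub>2]
    dro_value_le_dual_value[where h = h and x = x,
      OF assms(1) assms(3) \<open>compact \<Xi>\<close> h, of y Ahat \<epsilon>\<^sub>2]
    dual_value_le_minimax_value[where h = h and x = x,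
      OF assms(1) \<open>compact \<Xi>\<close> \<open>convex \<Xi>\<close> h, of y Ahat \<epsilon>\<^sub>1 \<epsilon>\<^sub>2]
  then show "dro_value n y Ahat \<epsilon>\<^sub>1 \<epsilon>\<^sub>2 \<Xi> h x = minimax_value n y Ahat \<epsilon>\<^sub>1 \<epsilon>\<^sub>2 \<Xi> h x"
    and "dual_value n y Ahat \<epsilon>\<^sub>1 \<epsilon>\<^sub>2 \<Xi> h x = minimax_value n y Ahat \<epsilon>\<^sub>1 \<epsilon>\<^sub>2 \<Xi> h x"
    by (meson order.antisym order.trans)+
  show "jointly_concave (\<lambda>A \<xi>. minimax_objective n y h x A \<xi>)"
    by (rule jointly_concave_minimax_objective[where h = h and x = x,
      OF h])
next
  show "convex_on D (\<lambda>x. minimax_objective n y h x A \<xi>)" for A \<xi>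
    using assms(5,10) by (rule convex_on_minimax_objective)
  show "jointly_convex_set (minimax_feasible n y Ahat \<epsilon>\<^sub>1 \<epsilon>\<^sub>2 \<Xi>)"
    using assms(8) by (rule jointly_convex_set_minimax_feasible)
qed

end
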